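(* For integers $n\ge 1$ and $l,k\ge 0$, let $N_n(l,k)$ be the number of vertices of the random graph $G_1^n$ with degree $l$, with second degree $k$, and without loops: $$N_n(l,k)=\#\{t\in G_1^n : d(t)=l,\ d_2(t)=k,\ tt\notin G_1^n\}.$$ Define constants $c(l,k)$ for integers $l,k\ge 0$ by $$c(l,0)=c(0,k)=0,$$ $$c(1,k)=\frac{2k^2+14k}{(k+1)(k+2)(k+3)(k+4)},$$ $$c(l,k)=c(l,k-1)\,\frac{l+k-1}{2l+k+2}+c(l-1,k)\,\frac{l-1}{2l+k+2},\qquad k>0,\ l>1.$$ Then for all integers $n\ge 1$ and $l,k\ge 0$, $$\mathbb{E}\,N_n(l,k)=n\,c(l,k)\,\bigl(1+\theta(n,l,k)\bigr)$$ for some real number $\theta(n,l,k)$ with $$|\theta(n,l,k)|<\frac{(2l+k-1)^2}{n}.$$ In the degenerate case $(l,k)=(0,1)$, where the right-hand side of the bound is $0$, the assertion is simply $\mathbb{E}\,N_n(0,1)=n\,c(0,1)=0$.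
   Context: The Bollob\'as--Riordan random graph $G_1^n$ (case $m=1$) on the vertex set $\{1,\dots,n\}$ is constructed inductively. $G_1^1$ is the graph with one vertex $1$ and one loop at it. Given $G_1^{t-1}$ ($t\ge 2$), the graph $G_1^t$ is obtained by adding the vertex $t$ and one edge between $t$ and $i$, where $i\in\{1,\dots,t\}$ is chosen randomly (conditionally on $G_1^{t-1}$) with $$\mathrm{P}(i=s)=\begin{cases} d_{G_1^{t-1}}(s)/(2t-1), & 1\le s\le t-1,\\ 1/(2t-1), & s=t.\end{cases}$$ Here $d_{G}(s)$ is the degree of the vertex $s$ in $G$; a loop contributes $2$ to the degree. If $i=t$ the new edge is a loop at $t$. We write $d(s)=d_{G_1^n}(s)$, and $ij\in G_1^n$ means that $G_1^n$ has the edge $ij$ (so $tt\in G_1^n$ means there is a loop at $t$). For a vertex $t\in G_1^n$ the second degree of $t$ is $$d_2(t)=\#\{ij : i\neq t,\ j\neq t,\ it\in G_1^n,\ ij\in G_1^n\},$$ i.e. the number of edges adjacent to the neighbors of $t$, except for the edges adjacent to $t$. A loop at a neighbor $i\ne t$ of $t$ contributes $2$ to $d_2(t)$, just as it contributes $2$ to the degree of $i$. (In $G_1^n$ every non-loop edge joins a vertex to an earlier one and each vertex emits one edge, so there are no multiple edges and no non-loop edges between two neighbors of $t$. Thus $d_2(t)=\sum_{i}(d_{G_1^n}(i)-1)$, the sum being over all vertices $i\ne t$ adjacent to $t$.) *)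

theory Defs
  imports "HOL-Probability.Probability"
begin

(* A graph on the vertex set {1..n} is given by its set of edges; the edge ij is the set {i, j},
   so a loop at t is the singleton {t}.  A set suffices, rather than a multiset: the process
   never creates a parallel edge, since every new edge contains the new vertex. *)

type_synonym edges = "nat set set"

definition vertex_degree :: "edges \<Rightarrow> nat \<Rightarrow> nat" where
  "vertex_degree E s = card {e \<in> E. s \<in> e} + (if {s} \<in> E then 1 else 0)"

(* The second summand gives a loop at a neighbour i its second unit: such a loop
   is already counted once, as the edge {i, i}, by the first summand. *)
definition second_degree :: "edges \<Rightarrow> nat \<Rightarrow> nat" where
  "second_degree E t =
     card {{i, j} | i j. i \<noteq> t \<and> j \<noteq> t \<and> {i, t} \<in> E \<and> {i, j} \<in> E} +
     card {i. i \<noteq> t \<and> {i, t} \<in> E \<and> {i} \<in> E}"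

definition attach_prob :: "nat \<Rightarrow> edges \<Rightarrow> nat \<Rightarrow> real" where
  "attach_prob t E s =
     (if 1 \<le> s \<and> s \<le> t - 1 then real (vertex_degree E s) / (2 * real t - 1)
      else if s = t then 1 / (2 * real t - 1)
      else 0)"

(* embed_pmf is only meaningful if the weights sum to 1; lemma pmf_attach_pmf
   below shows that they do for every graph E the process can reach. *)
definition attach_pmf :: "nat \<Rightarrow> edges \<Rightarrow> nat pmf" where
  "attach_pmf t E = embed_pmf (attach_prob t E)"

(* The value at 0 is irrelevant. *)
fun bollobas_riordan :: "nat \<Rightarrow> edges pmf" where
  "bollobas_riordan 0 = return_pmf {}"
| "bollobas_riordan (Suc 0) = return_pmf {{1}}"
| "bollobas_riordan (Suc (Suc m)) =
     bind_pmf (bollobas_riordan (Suc m))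
       (\<lambda>E. map_pmf (\<lambda>i. insert {Suc (Suc m), i} E) (attach_pmf (Suc (Suc m)) E))"

definition num_vertices :: "nat \<Rightarrow> nat \<Rightarrow> nat \<Rightarrow> edges \<Rightarrow> nat" where
  "num_vertices n l k E =
     card {t \<in> {1..n}. vertex_degree E t = l \<and> second_degree E t = k \<and> {t} \<notin> E}"

fun c_const :: "nat \<Rightarrow> nat \<Rightarrow> real" where
  "c_const l k =
     (if l = 0 \<or> k = 0 then 0
      else if l = 1 then
        (2 * real k ^ 2 + 14 * real k) /
        ((real k + 1) * (real k + 2) * (real k + 3) * (real k + 4))
      else
        c_const l (k - 1) * ((real l + real k - 1) / (2 * real l + real k + 2)) +
        c_const (l - 1) k * ((real l - 1) / (2 * real l + real k + 2)))"

declare c_const.simps [simp del]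

definition wf_edges :: "nat \<Rightarrow> edges \<Rightarrow> bool" where
  "wf_edges n E \<longleftrightarrow> finite E \<and> card E = n \<and>
     (\<forall>e\<in>E. \<exists>i\<in>{1..n}. \<exists>j\<in>{1..n}. e = {i, j})"

lemma sum_degree:
  assumes "wf_edges n E"
  shows "(\<Sum>s\<in>{1..n}. vertex_degree E s) = 2 * n"
proof -
  have fin: "finite E" and E: "\<And>e. e \<in> E \<Longrightarrow> \<exists>i\<in>{1..n}. \<exists>j\<in>{1..n}. e = {i, j}"
    and cE: "card E = n"
    using assms by (auto simp: wf_edges_def)
  have deg: "vertex_degree E s = (\<Sum>e\<in>E. (if s \<in> e then 1 else 0) + (if e = {s} then 1 else 0))" for s
  proof -
    have "(\<Sum>e\<in>E. if s \<in> e then 1 else 0 :: nat) = card {e \<in> E. s \<in> e}"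
      using fin by (simp add: sum.If_cases Int_def)
    moreover have "(\<Sum>e\<in>E. if e = {s} then 1 else 0 :: nat) = (if {s} \<in> E then 1 else 0)"
      using fin by simp
    ultimately show ?thesis by (simp add: vertex_degree_def sum.distrib)
  qed
  have two: "(\<Sum>s\<in>{1..n}. (if s \<in> e then 1 else 0) + (if e = {s} then 1 else 0)) = (2::nat)"
    if "e \<in> E" for e
  proof -
    obtain i j where e: "e = {i, j}" and ij: "i \<in> {1..n}" "j \<in> {1..n}" using E[OF \<open>e \<in> E\<close>] by blast
    have "(\<Sum>s\<in>{1..n}. if s \<in> e then 1 else 0 :: nat) = card ({1..n} \<inter> e)"
      by (simp add: sum.If_cases)
    also have "{1..n} \<inter> e = e" using e ij by auto
    finally have A: "(\<Sum>s\<in>{1..n}. if s \<in> e then 1 else 0 :: nat) = card e" .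
    have B: "(\<Sum>s\<in>{1..n}. if e = {s} then 1 else 0 :: nat) = (if i = j then 1 else 0)"
    proof (cases "i = j")
      case True
      then have "e = {s} \<longleftrightarrow> s = i" for s using e by auto
      then show ?thesis using True ij by simp
    next
      case False
      then have "e \<noteq> {s}" for s using e by auto
      then show ?thesis using False by simp
    qed
    show ?thesis using A B e by (simp add: sum.distrib)
  qed
  have "(\<Sum>s\<in>{1..n}. vertex_degree E s) =
      (\<Sum>e\<in>E. \<Sum>s\<in>{1..n}. (if s \<in> e then 1 else 0) + (if e = {s} then 1 else 0))"
    unfolding deg by (rule sum.swap)
  also have "\<dots> = (\<Sum>e\<in>E. 2)" by (rule sum.cong) (use two in auto)
  finally show ?thesis using cE by simp
qed

lemma pmf_attach_pmf_wf:
  assumes "wf_edges n E"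
  shows "pmf (attach_pmf (Suc n) E) s = attach_prob (Suc n) E s"
proof -
  have nonneg: "attach_prob (Suc n) E s \<ge> 0" for s by (auto simp: attach_prob_def)
  have z: "attach_prob (Suc n) E s = 0" if "s \<notin> {1..Suc n}" for s
    using that by (auto simp: attach_prob_def)
  have "(\<Sum>s\<in>{1..Suc n}. attach_prob (Suc n) E s) =
      (\<Sum>s\<in>{1..n}. attach_prob (Suc n) E s) + attach_prob (Suc n) E (Suc n)"
    by simp
  also have "(\<Sum>s\<in>{1..n}. attach_prob (Suc n) E s) =
      (\<Sum>s\<in>{1..n}. real (vertex_degree E s) / (2 * real n + 1))"
    by (rule sum.cong) (auto simp: attach_prob_def)
  also have "\<dots> = real (\<Sum>s\<in>{1..n}. vertex_degree E s) / (2 * real n + 1)"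
    by (simp add: sum_divide_distrib)
  also have "\<dots> = 2 * real n / (2 * real n + 1)" using sum_degree[OF assms] by simp
  finally have sum1: "(\<Sum>s\<in>{1..Suc n}. attach_prob (Suc n) E s) = 1"
    by (simp add: attach_prob_def field_simps)
  have "(\<integral>\<^sup>+ s. ennreal (attach_prob (Suc n) E s) \<partial>count_space UNIV) =
      (\<Sum>s\<in>{1..Suc n}. ennreal (attach_prob (Suc n) E s))"
    using z by (intro nn_integral_count_space') (auto simp: ennreal_eq_0_iff)
  also have "\<dots> = 1" using sum1 nonneg by (simp add: sum_ennreal del: sum.cl_ivl_Suc)
  finally show ?thesis unfolding attach_pmf_def by (intro pmf_embed_pmf) (use nonneg in auto)
qed

lemma wf_edges_bollobas_riordan:
  "E \<in> set_pmf (bollobas_riordan n) \<Longrightarrow> wf_edges n E"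
proof (induction n arbitrary: E rule: bollobas_riordan.induct)
  case (3 m)
  then obtain E' s where E': "E' \<in> set_pmf (bollobas_riordan (Suc m))"
    and s: "s \<in> set_pmf (attach_pmf (Suc (Suc m)) E')"
    and E: "E = insert {Suc (Suc m), s} E'"
    by auto
  have wf: "wf_edges (Suc m) E'" using "3.IH" E' by blast
  have "attach_prob (Suc (Suc m)) E' s \<noteq> 0"
    using s pmf_attach_pmf_wf[OF wf] by (simp add: set_pmf_iff)
  then have s': "s \<in> {1..Suc (Suc m)}" by (auto simp: attach_prob_def split: if_splits)
  have new: "{Suc (Suc m), s} \<notin> E'"
  proof
    assume "{Suc (Suc m), s} \<in> E'"
    then obtain i j where ij: "{Suc (Suc m), s} = {i, j}" and "i \<in> {1..Suc m}" "j \<in> {1..Suc m}"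
      using wf unfolding wf_edges_def by meson
    then have "i \<le> Suc m" "j \<le> Suc m" by auto
    moreover have "Suc (Suc m) \<in> {i, j}" unfolding ij[symmetric] by simp
    ultimately show False by auto
  qed
  have edge: "\<exists>i\<in>{1..Suc (Suc m)}. \<exists>j\<in>{1..Suc (Suc m)}. e = {i, j}" if e: "e \<in> E" for e
  proof (cases "e \<in> E'")
    case True
    then obtain i j where "e = {i, j}" and ij: "i \<in> {1..Suc m}" "j \<in> {1..Suc m}"
      using wf unfolding wf_edges_def by meson
    moreover have "i \<in> {1..Suc (Suc m)}" "j \<in> {1..Suc (Suc m)}" using ij by auto
    ultimately show ?thesis by metis
  next
    case False
    then have "e = {Suc (Suc m), s}" using e E by simp
    moreover have "Suc (Suc m) \<in> {1..Suc (Suc m)}" by simp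
    ultimately show ?thesis using s' by metis
  qed
  have "finite E" and "card E = Suc (Suc m)"
    using wf new unfolding E wf_edges_def by simp_all
  then show ?case using edge unfolding wf_edges_def by metis
qed (auto simp: wf_edges_def)

lemma pmf_attach_pmf:
  assumes "t \<ge> 2" "E \<in> set_pmf (bollobas_riordan (t - 1))"
  shows "pmf (attach_pmf t E) s = attach_prob t E s"
  using pmf_attach_pmf_wf[OF wf_edges_bollobas_riordan[OF assms(2)], of s] assms(1) by simp

end

theory Submission
  imports Defs
begin

text \<open>When the vertex \<open>t + 1\<close> arrives, an old loopless vertex of degree \<open>l\<close> and second degree \<open>k\<close>
  gains degree with probability \<open>l / (2 * t + 1)\<close>, and second degree with probability
  \<open>(l + k) / (2 * t + 1)\<close>, since the degrees of its neighbours add up to \<open>l + k\<close>.  The new vertex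
  has degree 1, and its second degree is the former degree of the vertex it chooses.  This gives
  linear recurrences in \<open>t\<close> for the expected counts.  For \<open>l \<ge> 2\<close> the profile
  \<open>c_const l k * (t + 1/2)\<close> satisfies the same recurrence exactly, so the deviation from it is
  propagated by nonnegative coefficients, and with \<open>M = 2 * l + k\<close> it stays below
  \<open>M * (M - 2) * c_const l k\<close> because \<open>(M - 1) * (M - 3) * (M + 2) \<le> M * (M - 2) * M\<close>.
  As \<open>M * (M - 2) = (M - 1)\<^sup>2 - 1\<close>, there is room for the shift of \<open>t\<close> by \<open>1/2\<close>.
  For \<open>l = 1\<close> the recurrence has a source term, the expected number of vertices of degree \<open>k\<close>;
  \<open>k\<close> times this number deviates from its own linear profile by at most \<open>3/2\<close>.  Whenever the
  coefficient \<open>1 - M / (2 * t + 1)\<close> is negative, the count it multiplies vanishes.\<close>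

section \<open>One step of the process\<close>

definition neighbours :: "edges \<Rightarrow> nat \<Rightarrow> nat set" where
  "neighbours E v = {i. i \<noteq> v \<and> {i, v} \<in> E}"

text \<open>Unlike \<open>num_vertices\<close>, this counts vertices with a loop as well: the new
  vertex may attach to one of them, and its second degree is then the full degree of that
  vertex.\<close>

definition degree_count :: "nat \<Rightarrow> nat \<Rightarrow> edges \<Rightarrow> nat" where
  "degree_count n k E = card {s \<in> {1..n}. vertex_degree E s = k}"

lemma wf_edges_memD:
  assumes "wf_edges n E" "e \<in> E" "x \<in> e"
  shows "1 \<le> x" "x \<le> n"
proof -
  obtain i j where "i \<in> {1..n}" "j \<in> {1..n}" "e = {i, j}"
    using assms unfolding wf_edges_def by meson
  then show "1 \<le> x" "x \<le> n" using assms(3) by auto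
qed

lemma wf_edges_incident:
  assumes "wf_edges n E" "e \<in> E" "x \<in> e"
  obtains y where "e = {x, y}"
proof -
  obtain i j where "e = {i, j}"
    using assms unfolding wf_edges_def by meson
  then show ?thesis using assms(3) that by (cases "x = i") auto
qed

lemma neighbours_subset:
  assumes "wf_edges n E"
  shows "neighbours E v \<subseteq> {1..n}"
  using wf_edges_memD[OF assms] unfolding neighbours_def by fastforce

lemma finite_neighbours: "wf_edges n E \<Longrightarrow> finite (neighbours E v)"
  by (rule finite_subset[OF neighbours_subset]) simp_all

section \<open>Effect of a new edge on degrees, neighbours and second degrees\<close>

context
  fixes n E
  assumes wf: "wf_edges n E"
begin

private lemma fin: "finite E"
  using wf by (simp add: wf_edges_def)

private lemma new_notin: "e \<in> E \<Longrightarrow> Suc n \<in> e \<Longrightarrow> False"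
  using wf_edges_memD(2)[OF wf] by fastforce

private lemma new_notin_pair: "{Suc n, i} \<notin> E" "{i, Suc n} \<notin> E" "{Suc n} \<notin> E"
  using new_notin by blast+

lemma loop_insert_iff:
  assumes "v \<le> n"
  shows "{v} \<in> insert {Suc n, i} E \<longleftrightarrow> {v} \<in> E"
  using assms by (auto simp: doubleton_eq_iff)

lemma loop_new_iff: "{Suc n} \<in> insert {Suc n, i} E \<longleftrightarrow> i = Suc n"
  using new_notin_pair by auto

lemma vertex_degree_insert:
  assumes "v \<le> n"
  shows "vertex_degree (insert {Suc n, i} E) v = vertex_degree E v + (if i = v then 1 else 0)"
proof -
  have "{e \<in> insert {Suc n, i} E. v \<in> e} =
      (if i = v then insert {Suc n, i} {e \<in> E. v \<in> e} else {e \<in> E. v \<in> e})"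
    using assms by auto
  moreover have "card (insert {Suc n, i} {e \<in> E. v \<in> e}) = Suc (card {e \<in> E. v \<in> e})"
    using fin new_notin_pair by simp
  ultimately show ?thesis
    unfolding vertex_degree_def loop_insert_iff[OF assms] by (cases "i = v") simp_all
qed

lemma vertex_degree_new:
  "vertex_degree (insert {Suc n, i} E) (Suc n) = (if i = Suc n then 2 else 1)"
proof -
  have "{e \<in> insert {Suc n, i} E. Suc n \<in> e} = {{Suc n, i}}"
    using new_notin by auto
  then show ?thesis
    using loop_new_iff unfolding vertex_degree_def by simp
qed

lemma neighbours_insert:
  assumes "v \<le> n"
  shows "neighbours (insert {Suc n, i} E) v =
    (if i = v then insert (Suc n) (neighbours E v) else neighbours E v)"
  using assms unfolding neighbours_def by (auto simp: doubleton_eq_iff)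

lemma neighbours_new:
  assumes "i \<le> n"
  shows "neighbours (insert {Suc n, i} E) (Suc n) = {i}"
  using assms new_notin_pair unfolding neighbours_def by (auto simp: doubleton_eq_iff)

text \<open>Only an edge attached to a neighbour of \<open>v\<close> counts. Attaching to
  \<open>v\<close> itself makes the new vertex a neighbour of \<open>v\<close>, but its only edge
  leads back to \<open>v\<close> and is excluded.\<close>

lemma second_degree_insert:
  assumes "v \<le> n"
  shows "second_degree (insert {Suc n, i} E) v =
    second_degree E v + (if i \<in> neighbours E v then 1 else 0)"
proof -
  let ?A = "\<lambda>E. {{i, j} | i j. i \<noteq> v \<and> j \<noteq> v \<and> {i, v} \<in> E \<and> {i, j} \<in> E}"
  let ?B = "\<lambda>E. {i. i \<noteq> v \<and> {i, v} \<in> E \<and> {i} \<in> E}"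
  let ?E = "insert {Suc n, i} E"
  have B: "?B ?E = ?B E"
    using assms new_notin_pair by (auto simp: doubleton_eq_iff)
  have sub: "?A E \<subseteq> E" by auto
  have A: "?A ?E = (if i \<in> neighbours E v then insert {Suc n, i} (?A E) else ?A E)"
    (is "_ = ?R")
  proof
    show "?A ?E \<subseteq> ?R"
    proof
      fix e assume "e \<in> ?A ?E"
      then obtain a b where ab: "e = {a, b}" "a \<noteq> v" "b \<noteq> v" "{a, v} \<in> ?E" "{a, b} \<in> ?E"
        by blast
      consider "a = Suc n" | "a \<noteq> Suc n" by blast
      then show "e \<in> ?R"
      proof cases
        case 1
        then have "i = v" using ab new_notin_pair assms by (auto simp: doubleton_eq_iff)
        moreover have "i = b"
          using ab 1 new_notin_pair by (auto simp: doubleton_eq_iff)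
        ultimately show ?thesis using ab by simp
      next
        case 2
        then have av: "{a, v} \<in> E" using ab assms by (auto simp: doubleton_eq_iff)
        show ?thesis
        proof (cases "{a, b} \<in> E")
          case True
          then have "e \<in> ?A E" using ab av by blast
          then show ?thesis by simp
        next
          case False
          then have eq: "{a, b} = {Suc n, i}" using ab by simp
          then have "a = i" using 2 by (auto simp: doubleton_eq_iff)
          then have "i \<in> neighbours E v" using av ab(2) by (simp add: neighbours_def)
          then show ?thesis using eq ab(1) by simp
        qed
      qed
    qed
    have "{Suc n, i} \<in> ?A ?E" if "i \<in> neighbours E v"
    proof -
      have mem: "{Suc n, i} = {i, Suc n} \<and> i \<noteq> v \<and> Suc n \<noteq> v \<and> {i, v} \<in> ?E \<and> {i, Suc n} \<in> ?E"
        using that assms by (auto simp: neighbours_def)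
      show ?thesis by (rule CollectI, rule exI[of _ i], rule exI[of _ "Suc n"], rule mem)
    qed
    moreover have "?A E \<subseteq> ?A ?E" by blast
    ultimately show "?R \<subseteq> ?A ?E" by simp
  qed
  have "finite (?A E)" "{Suc n, i} \<notin> ?A E"
    using finite_subset[OF sub fin] subsetD[OF sub] new_notin_pair(1) by blast+
  then have "card (?A ?E) = card (?A E) + (if i \<in> neighbours E v then 1 else 0)"
    unfolding A by simp
  then show ?thesis unfolding second_degree_def B by simp
qed

text \<open>The only neighbour of the new vertex is \<open>i\<close>, and the edges at
  \<open>i\<close> other than the new one are those it had in \<open>E\<close>. A loop at
  \<open>i\<close> counts twice on both sides.\<close>

lemma second_degree_new:
  assumes "i \<le> n"
  shows "second_degree (insert {Suc n, i} E) (Suc n) = vertex_degree E i"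
proof -
  let ?E = "insert {Suc n, i} E"
  have "{{a, j} | a j. a \<noteq> Suc n \<and> j \<noteq> Suc n \<and> {a, Suc n} \<in> ?E \<and> {a, j} \<in> ?E}
      = {e \<in> E. i \<in> e}" (is "?L = ?R")
  proof
    show "?L \<subseteq> ?R"
    proof
      fix e assume "e \<in> ?L"
      then obtain a j where aj: "e = {a, j}" "a \<noteq> Suc n" "j \<noteq> Suc n" "{a, Suc n} \<in> ?E"
        "{a, j} \<in> ?E" by blast
      then have "a = i" "{a, j} \<in> E" using new_notin_pair by (auto simp: doubleton_eq_iff)
      then show "e \<in> ?R" using aj by simp
    qed
    show "?R \<subseteq> ?L"
    proof
      fix e assume e: "e \<in> ?R"
      then obtain j where j: "e = {i, j}" using wf_edges_incident[OF wf] by blast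
      then have "j \<noteq> Suc n" using e new_notin by blast
      then have mem: "e = {i, j} \<and> i \<noteq> Suc n \<and> j \<noteq> Suc n \<and> {i, Suc n} \<in> ?E \<and> {i, j} \<in> ?E"
        using j e assms by auto
      show "e \<in> ?L" by (rule CollectI, rule exI[of _ i], rule exI[of _ j], rule mem)
    qed
  qed
  moreover have "{a. a \<noteq> Suc n \<and> {a, Suc n} \<in> ?E \<and> {a} \<in> ?E} = (if {i} \<in> E then {i} else {})"
    using assms new_notin_pair by (auto simp: doubleton_eq_iff)
  ultimately show ?thesis unfolding second_degree_def vertex_degree_def by simp
qed

end

text \<open>This encodes that neighbours of a loopless vertex are never joined to each other;
  it is the only global property of the graph that the evolution of the second degree needs.\<close>

definition neighbour_degree_identity :: "nat \<Rightarrow> edges \<Rightarrow> bool" where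
  "neighbour_degree_identity n E \<longleftrightarrow>
     (\<forall>v\<in>{1..n}. {v} \<notin> E \<longrightarrow>
        (\<Sum>i\<in>neighbours E v. vertex_degree E i) = vertex_degree E v + second_degree E v)"

text \<open>Both sides change together. For an old \<open>v\<close>, attaching to \<open>v\<close>
  adds a neighbour of degree 1 and raises the degree of \<open>v\<close>, while attaching to a
  neighbour raises that degree and the second degree of \<open>v\<close>. For a loopless new vertex,
  its neighbour \<open>i\<close> contributes the old degree of \<open>i\<close> plus one.\<close>

lemma neighbour_degree_identity_insert:
  assumes wf: "wf_edges n E" and id: "neighbour_degree_identity n E" and i: "1 \<le> i" "i \<le> Suc n"
  shows "neighbour_degree_identity (Suc n) (insert {Suc n, i} E)"
  unfolding neighbour_degree_identity_def
proof (intro ballI impI)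
  let ?E = "insert {Suc n, i} E"
  fix v assume v: "v \<in> {1..Suc n}" and loop: "{v} \<notin> ?E"
  show "(\<Sum>i\<in>neighbours ?E v. vertex_degree ?E i) = vertex_degree ?E v + second_degree ?E v"
  proof (cases "v = Suc n")
    case True
    then have "i \<le> n" using loop i by (cases "i = Suc n") auto
    then show ?thesis using True
      by (simp add: neighbours_new[OF wf] vertex_degree_insert[OF wf] vertex_degree_new[OF wf]
          second_degree_new[OF wf])
  next
    case False
    then have vn: "v \<le> n" using v by simp
    have old: "(\<Sum>i\<in>neighbours E v. vertex_degree E i) = vertex_degree E v + second_degree E v"
      using id v vn loop unfolding neighbour_degree_identity_def by simp
    have fin: "finite (neighbours E v)" by (rule finite_neighbours[OF wf])
    have le: "j \<le> n" if "j \<in> neighbours E v" for j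
      using neighbours_subset[OF wf, of v] that by auto
    have "(\<Sum>j\<in>neighbours E v. vertex_degree ?E j) =
        (\<Sum>j\<in>neighbours E v. vertex_degree E j + (if i = j then 1 else 0))"
      by (rule sum.cong) (simp_all add: le vertex_degree_insert[OF wf])
    then have sum: "(\<Sum>j\<in>neighbours E v. vertex_degree ?E j) =
        (\<Sum>j\<in>neighbours E v. vertex_degree E j) + (if i \<in> neighbours E v then 1 else 0)"
      using fin by (simp add: sum.distrib)
    show ?thesis
    proof (cases "i = v")
      case True
      have "Suc n \<notin> neighbours E v" using le by fastforce
      moreover have "v \<notin> neighbours E v" by (simp add: neighbours_def)
      ultimately show ?thesis
        using True old sum fin vn
        by (simp add: neighbours_insert[OF wf] vertex_degree_insert[OF wf] vertex_degree_new[OF wf]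
            second_degree_insert[OF wf])
    next
      case False
      then show ?thesis
        using old sum vn
        by (simp add: neighbours_insert[OF wf] vertex_degree_insert[OF wf]
            second_degree_insert[OF wf])
    qed
  qed
qed

lemma set_attach_pmf:
  assumes "wf_edges n E"
  shows "set_pmf (attach_pmf (Suc n) E) \<subseteq> {1..Suc n}"
  using pmf_attach_pmf_wf[OF assms] by (auto simp: set_pmf_iff attach_prob_def split: if_splits)

lemma neighbour_degree_identity_bollobas_riordan:
  "E \<in> set_pmf (bollobas_riordan n) \<Longrightarrow> neighbour_degree_identity n E"
proof (induction n arbitrary: E rule: bollobas_riordan.induct)
  case (3 m)
  then obtain E' i where E': "E' \<in> set_pmf (bollobas_riordan (Suc m))"
    and i: "i \<in> set_pmf (attach_pmf (Suc (Suc m)) E')"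
    and E: "E = insert {Suc (Suc m), i} E'"
    by auto
  have wf: "wf_edges (Suc m) E'" using E' by (rule wf_edges_bollobas_riordan)
  have "1 \<le> i" "i \<le> Suc (Suc m)" using set_attach_pmf[OF wf] i by auto
  then show ?case
    unfolding E using neighbour_degree_identity_insert[OF wf "3.IH"[OF E']] by simp
qed (auto simp: neighbour_degree_identity_def)

section \<open>Averaging over one step of the process\<close>

lemma finite_set_bollobas_riordan: "finite (set_pmf (bollobas_riordan n))"
proof (induction n rule: bollobas_riordan.induct)
  case (3 m)
  have "finite (set_pmf (attach_pmf (Suc (Suc m)) E))" if "E \<in> set_pmf (bollobas_riordan (Suc m))" for E
    using set_attach_pmf[OF wf_edges_bollobas_riordan[OF that]] by (rule finite_subset) simp
  then show ?case using 3 by simp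
qed auto

lemma expectation_bollobas_riordan_Suc:
  fixes h :: "edges \<Rightarrow> real"
  assumes "n \<ge> 1"
  shows "measure_pmf.expectation (bollobas_riordan (Suc n)) h =
    measure_pmf.expectation (bollobas_riordan n)
      (\<lambda>E. \<Sum>i\<in>{1..Suc n}. attach_prob (Suc n) E i * h (insert {Suc n, i} E))"
proof -
  let ?p = "bollobas_riordan n"
  let ?g = "\<lambda>E. map_pmf (\<lambda>i. insert {Suc n, i} E) (attach_pmf (Suc n) E)"
  have eq: "bollobas_riordan (Suc n) = bind_pmf ?p ?g"
    using assms by (cases n) auto
  have fin: "finite (set_pmf (?g E))" if "E \<in> set_pmf ?p" for E
    using finite_subset[OF set_attach_pmf[OF wf_edges_bollobas_riordan[OF that]]] by simp
  have "measure_pmf.expectation (?g E) h =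
      (\<Sum>i\<in>{1..Suc n}. attach_prob (Suc n) E i * h (insert {Suc n, i} E))"
    if "E \<in> set_pmf ?p" for E
  proof -
    have wf: "wf_edges n E" by (rule wf_edges_bollobas_riordan[OF that])
    have "measure_pmf.expectation (?g E) h =
        measure_pmf.expectation (attach_pmf (Suc n) E) (\<lambda>i. h (insert {Suc n, i} E))"
      by simp
    also have "\<dots> = (\<Sum>i\<in>{1..Suc n}. h (insert {Suc n, i} E) * pmf (attach_pmf (Suc n) E) i)"
      by (rule integral_measure_pmf_real) (use set_attach_pmf[OF wf] in auto)
    finally show ?thesis by (simp add: pmf_attach_pmf_wf[OF wf] mult.commute del: sum.cl_ivl_Suc)
  qed
  then have "(\<Sum>E\<in>set_pmf ?p. pmf ?p E *\<^sub>R measure_pmf.expectation (?g E) h) =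
      (\<Sum>E\<in>set_pmf ?p. pmf ?p E *\<^sub>R
        (\<Sum>i\<in>{1..Suc n}. attach_prob (Suc n) E i * h (insert {Suc n, i} E)))"
    by (simp del: sum.cl_ivl_Suc)
  moreover have "measure_pmf.expectation (bind_pmf ?p ?g) h =
      (\<Sum>E\<in>set_pmf ?p. pmf ?p E *\<^sub>R measure_pmf.expectation (?g E) h)"
    by (rule pmf_expectation_bind) (use finite_set_bollobas_riordan fin in auto)
  ultimately show ?thesis
    unfolding eq
    by (simp add: integral_measure_pmf_real[OF finite_set_bollobas_riordan] mult.commute
        del: sum.cl_ivl_Suc)
qed

section \<open>Recurrences for the expected counts\<close>

lemma attach_prob_old:
  assumes "1 \<le> i" "i \<le> n"
  shows "attach_prob (Suc n) E i = real (vertex_degree E i) / (2 * real n + 1)"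
  using assms by (simp add: attach_prob_def)

lemma attach_prob_new: "attach_prob (Suc n) E (Suc n) = 1 / (2 * real n + 1)"
  by (simp add: attach_prob_def)

lemma sum_attach_prob:
  assumes "wf_edges n E"
  shows "(\<Sum>i\<in>{1..Suc n}. attach_prob (Suc n) E i) = 1"
  using sum_pmf_eq_1[OF _ set_attach_pmf[OF assms]]
  by (simp add: pmf_attach_pmf_wf[OF assms] del: sum.cl_ivl_Suc)

lemma sum_attach_prob_select:
  assumes "1 \<le> v" "v \<le> n"
  shows "(\<Sum>i\<in>{1..Suc n}. attach_prob (Suc n) E i * of_bool (i = v)) =
    real (vertex_degree E v) / (2 * real n + 1)"
proof -
  have "(\<Sum>i\<in>{1..Suc n}. attach_prob (Suc n) E i * of_bool (i = v)) =
      (\<Sum>i\<in>{1..Suc n}. if i = v then attach_prob (Suc n) E i else 0)"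
    by (rule sum.cong) auto
  then show ?thesis using assms attach_prob_old[OF assms] by (simp del: sum.cl_ivl_Suc)
qed

text \<open>The neighbours of \<open>v\<close> are chosen with total weight equal to the sum of
  their degrees. The identity turns this sum into a function of the degree and second degree of
  \<open>v\<close>, which is what makes the recurrence close.\<close>

lemma sum_attach_prob_neighbours:
  assumes wf: "wf_edges n E" and "neighbour_degree_identity n E"
    and "1 \<le> v" "v \<le> n" "{v} \<notin> E"
  shows "(\<Sum>i\<in>{1..Suc n}. attach_prob (Suc n) E i * of_bool (i \<in> neighbours E v)) =
    (real (vertex_degree E v) + real (second_degree E v)) / (2 * real n + 1)"
proof -
  have sub: "neighbours E v \<subseteq> {1..n}" by (rule neighbours_subset[OF wf])
  have "(\<Sum>i\<in>{1..Suc n}. attach_prob (Suc n) E i * of_bool (i \<in> neighbours E v)) =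
      (\<Sum>i\<in>neighbours E v. attach_prob (Suc n) E i)"
    by (rule sum.mono_neutral_cong_right) (use sub in auto)
  also have "\<dots> = (\<Sum>i\<in>neighbours E v. real (vertex_degree E i) / (2 * real n + 1))"
    by (rule sum.cong) (use sub attach_prob_old in auto)
  also have "\<dots> = real (\<Sum>i\<in>neighbours E v. vertex_degree E i) / (2 * real n + 1)"
    by (simp add: sum_divide_distrib)
  finally show ?thesis
    using assms unfolding neighbour_degree_identity_def by simp
qed

lemma sum_attach_prob_degrees_old:
  assumes wf: "wf_edges n E" and id: "neighbour_degree_identity n E"
    and v: "1 \<le> v" "v \<le> n" "{v} \<notin> E"
  defines "d \<equiv> vertex_degree E v" and "d2 \<equiv> second_degree E v"
  shows "(\<Sum>i\<in>{1..Suc n}. attach_prob (Suc n) E i *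
      of_bool (vertex_degree (insert {Suc n, i} E) v = l \<and> second_degree (insert {Suc n, i} E) v = k)) =
    of_bool (d = l \<and> d2 = k) * (1 - (2 * real l + real k) / (2 * real n + 1)) +
    of_bool (Suc d = l \<and> d2 = k) * real (l - 1) / (2 * real n + 1) +
    of_bool (d = l \<and> Suc d2 = k) * real (l + k - 1) / (2 * real n + 1)" (is "?L = ?R")
proof -
  define q where "q = 2 * real n + 1"
  define a b c :: real where "a = of_bool (d = l \<and> d2 = k)"
    and "b = of_bool (Suc d = l \<and> d2 = k)" and "c = of_bool (d = l \<and> Suc d2 = k)"
  \<comment> \<open>As \<open>v\<close> is not its own neighbour, the events \<open>i = v\<close>
    and \<open>i \<in> neighbours E v\<close> are disjoint. The indicator is therefore
    \<open>a\<close>, replaced by \<open>b\<close> on the first event and by \<open>c\<close> on the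
    second.\<close>
  have "attach_prob (Suc n) E i * of_bool (vertex_degree (insert {Suc n, i} E) v = l \<and>
        second_degree (insert {Suc n, i} E) v = k) =
      a * attach_prob (Suc n) E i + (b - a) * (attach_prob (Suc n) E i * of_bool (i = v)) +
      (c - a) * (attach_prob (Suc n) E i * of_bool (i \<in> neighbours E v))" for i
    using v unfolding a_def b_def c_def
    by (cases "i = v"; cases "i \<in> neighbours E v")
       (simp_all add: vertex_degree_insert[OF wf] second_degree_insert[OF wf] d_def d2_def
          neighbours_def)
  then have "?L = a * (\<Sum>i\<in>{1..Suc n}. attach_prob (Suc n) E i) +
      (b - a) * (\<Sum>i\<in>{1..Suc n}. attach_prob (Suc n) E i * of_bool (i = v)) +
      (c - a) * (\<Sum>i\<in>{1..Suc n}. attach_prob (Suc n) E i * of_bool (i \<in> neighbours E v))"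
    by (simp only: sum.distrib sum_distrib_left)
  also have "\<dots> = a + (b - a) * (real d / (2 * real n + 1)) +
      (c - a) * ((real d + real d2) / (2 * real n + 1))"
    unfolding sum_attach_prob[OF wf] sum_attach_prob_select[OF v(1,2)]
      sum_attach_prob_neighbours[OF wf id v] d_def d2_def by simp
  also have "\<dots> = a * (1 - (2 * real d + real d2) / (2 * real n + 1)) +
      b * real d / (2 * real n + 1) + c * (real d + real d2) / (2 * real n + 1)"
    unfolding q_def[symmetric] by (simp add: add_divide_distrib diff_divide_distrib algebra_simps)
  \<comment> \<open>Wherever one of the indicators is nonzero, it expresses \<open>d\<close> and
    \<open>d2\<close> through \<open>l\<close> and \<open>k\<close>.\<close>
  also have "\<dots> = ?R"
    unfolding a_def b_def c_def by (auto simp: of_nat_diff)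
  finally show ?thesis .
qed

lemma num_vertices_eq_sum:
  "real (num_vertices n l k E) = (\<Sum>v\<in>{v\<in>{1..n}. {v} \<notin> E}.
    of_bool (vertex_degree E v = l \<and> second_degree E v = k))"
proof -
  have "{t \<in> {1..n}. vertex_degree E t = l \<and> second_degree E t = k \<and> {t} \<notin> E} =
      {v\<in>{1..n}. {v} \<notin> E} \<inter> {v. vertex_degree E v = l \<and> second_degree E v = k}" by auto
  then show ?thesis by (simp add: num_vertices_def)
qed

text \<open>A step neither creates nor removes loops at old vertices, so they are summed over the
  same set as before. The new vertex is loopless exactly when \<open>i \<le> n\<close>; it then has
  degree 1 and the old degree of \<open>i\<close> as its second degree.\<close>

lemma num_vertices_insert:
  assumes wf: "wf_edges n E" and i: "1 \<le> i" "i \<le> Suc n"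
  shows "real (num_vertices (Suc n) l k (insert {Suc n, i} E)) =
    (\<Sum>v\<in>{v\<in>{1..n}. {v} \<notin> E}. of_bool (vertex_degree (insert {Suc n, i} E) v = l \<and>
       second_degree (insert {Suc n, i} E) v = k)) +
    of_bool (l = 1 \<and> i \<le> n \<and> vertex_degree E i = k)"
proof -
  let ?E = "insert {Suc n, i} E"
  let ?S = "{v\<in>{1..n}. {v} \<notin> E}"
  have old: "v \<in> {1..Suc n} \<and> {v} \<notin> ?E \<longleftrightarrow> v \<in> ?S \<or> v = Suc n \<and> i \<le> n" for v
  proof (cases "v \<le> n")
    case True
    then show ?thesis unfolding loop_insert_iff[OF wf True] by auto
  next
    case False
    then show ?thesis using loop_new_iff[OF wf, of i] i
      by (cases "v = Suc n") (auto simp del: insert_iff)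
  qed
  show ?thesis
  proof (cases "i \<le> n")
    case True
    then have S: "{v\<in>{1..Suc n}. {v} \<notin> ?E} = insert (Suc n) ?S" using old by blast
    show ?thesis
      unfolding num_vertices_eq_sum S
      using True by (simp add: vertex_degree_new[OF wf] second_degree_new[OF wf] eq_commute[of 1])
  next
    case False
    then have S: "{v\<in>{1..Suc n}. {v} \<notin> ?E} = ?S" using old by blast
    show ?thesis unfolding num_vertices_eq_sum S using False by simp
  qed
qed

lemma degree_count_eq_sum:
  "real (degree_count n k E) = (\<Sum>v\<in>{1..n}. of_bool (vertex_degree E v = k))"
proof -
  have "{s \<in> {1..n}. vertex_degree E s = k} = {1..n} \<inter> {s. vertex_degree E s = k}" by auto
  then show ?thesis by (simp add: degree_count_def)
qed

text \<open>The last term is the new vertex: each of the vertices of degree \<open>k\<close> is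
  chosen with probability \<open>k / (2 * n + 1)\<close>. Truncated subtraction makes the factor
  \<open>real (l - 1)\<close> zero at \<open>l = 0\<close>, but \<open>real (l + k - 1)\<close> need
  not vanish at \<open>k = 0\<close>, hence the explicit \<open>if\<close>.\<close>

lemma sum_attach_prob_num_vertices:
  assumes wf: "wf_edges n E" and id: "neighbour_degree_identity n E"
  shows "(\<Sum>i\<in>{1..Suc n}. attach_prob (Suc n) E i *
      real (num_vertices (Suc n) l k (insert {Suc n, i} E))) =
    real (num_vertices n l k E) * (1 - (2 * real l + real k) / (2 * real n + 1)) +
    real (num_vertices n (l - 1) k E) * real (l - 1) / (2 * real n + 1) +
    (if k = 0 then 0 else real (num_vertices n l (k - 1) E) * real (l + k - 1) / (2 * real n + 1)) +
    (if l = 1 then real k * real (degree_count n k E) / (2 * real n + 1) else 0)"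
proof -
  let ?S = "{v\<in>{1..n}. {v} \<notin> E}"
  let ?q = "2 * real n + 1"
  let ?d = "vertex_degree E" and ?d2 = "second_degree E"
  let ?new = "\<lambda>i. of_bool (l = 1 \<and> i \<le> n \<and> ?d i = k) :: real"
  let ?old = "\<lambda>i v. of_bool (vertex_degree (insert {Suc n, i} E) v = l \<and>
       second_degree (insert {Suc n, i} E) v = k) :: real"
  have "(\<Sum>i\<in>{1..Suc n}. attach_prob (Suc n) E i *
      real (num_vertices (Suc n) l k (insert {Suc n, i} E))) =
      (\<Sum>i\<in>{1..Suc n}. attach_prob (Suc n) E i * ((\<Sum>v\<in>?S. ?old i v) + ?new i))"
    by (rule sum.cong) (simp_all add: num_vertices_insert[OF wf])
  also have "\<dots> = (\<Sum>i\<in>{1..Suc n}. \<Sum>v\<in>?S. attach_prob (Suc n) E i * ?old i v) +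
      (\<Sum>i\<in>{1..Suc n}. attach_prob (Suc n) E i * ?new i)"
    by (simp only: distrib_left sum.distrib sum_distrib_left)
  also have "(\<Sum>i\<in>{1..Suc n}. \<Sum>v\<in>?S. attach_prob (Suc n) E i * ?old i v) =
      (\<Sum>v\<in>?S. \<Sum>i\<in>{1..Suc n}. attach_prob (Suc n) E i * ?old i v)"
    by (rule sum.swap)
  also have "\<dots> = (\<Sum>v\<in>?S. of_bool (?d v = l \<and> ?d2 v = k) * (1 - (2 * real l + real k) / ?q) +
      of_bool (Suc (?d v) = l \<and> ?d2 v = k) * real (l - 1) / ?q +
      of_bool (?d v = l \<and> Suc (?d2 v) = k) * real (l + k - 1) / ?q)"
    by (rule sum.cong) (use sum_attach_prob_degrees_old[OF wf id] in auto)
  also have "\<dots> = real (num_vertices n l k E) * (1 - (2 * real l + real k) / ?q) +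
      (\<Sum>v\<in>?S. of_bool (Suc (?d v) = l \<and> ?d2 v = k)) * real (l - 1) / ?q +
      (\<Sum>v\<in>?S. of_bool (?d v = l \<and> Suc (?d2 v) = k)) * real (l + k - 1) / ?q"
    unfolding num_vertices_eq_sum
    by (simp only: sum.distrib sum_distrib_right sum_divide_distrib)
  also have "(\<Sum>v\<in>?S. of_bool (Suc (?d v) = l \<and> ?d2 v = k)) * real (l - 1) / ?q =
      real (num_vertices n (l - 1) k E) * real (l - 1) / ?q"
    unfolding num_vertices_eq_sum by (cases l) simp_all
  also have "(\<Sum>v\<in>?S. of_bool (?d v = l \<and> Suc (?d2 v) = k)) * real (l + k - 1) / ?q =
      (if k = 0 then 0 else real (num_vertices n l (k - 1) E) * real (l + k - 1) / ?q)"
    unfolding num_vertices_eq_sum by (cases k) simp_all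
  also have "(\<Sum>i\<in>{1..Suc n}. attach_prob (Suc n) E i * ?new i) =
      (\<Sum>i\<in>{1..n}. attach_prob (Suc n) E i * ?new i)"
    by simp
  also have "\<dots> = (\<Sum>i\<in>{1..n}. (if l = 1 then real k / ?q else 0) * of_bool (?d i = k))"
    by (rule sum.cong) (auto simp: attach_prob_old)
  also have "\<dots> = (if l = 1 then real k * real (degree_count n k E) / ?q else 0)"
    unfolding degree_count_eq_sum sum_distrib_left[symmetric] by simp
  finally show ?thesis .
qed

text \<open>The last term is the new vertex, which has degree 2 with probability
  \<open>1 / (2 * n + 1)\<close>, when it receives a loop, and degree 1 otherwise.\<close>

lemma sum_attach_prob_degree_count:
  assumes wf: "wf_edges n E"
  shows "(\<Sum>i\<in>{1..Suc n}. attach_prob (Suc n) E i *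
      real (degree_count (Suc n) k (insert {Suc n, i} E))) =
    real (degree_count n k E) * (1 - real k / (2 * real n + 1)) +
    real (degree_count n (k - 1) E) * real (k - 1) / (2 * real n + 1) +
    (of_bool (k = 1) * (2 * real n) + of_bool (k = 2)) / (2 * real n + 1)"
proof -
  let ?q = "2 * real n + 1"
  let ?d = "vertex_degree E"
  let ?p = "attach_prob (Suc n) E"
  let ?I = "{1..Suc n}"
  have count: "real (degree_count (Suc n) k (insert {Suc n, i} E)) =
      (\<Sum>v\<in>{1..n}. of_bool (?d v = k) + of_bool (i = v) * (of_bool (Suc (?d v) = k) - of_bool (?d v = k))) +
      (of_bool (k = 1) + of_bool (i = Suc n) * (of_bool (k = 2) - of_bool (k = 1)))"
    (is "_ = (\<Sum>v\<in>{1..n}. ?f i v) + ?g i") for i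
  proof -
    have "(\<Sum>v\<in>{1..n}. of_bool (vertex_degree (insert {Suc n, i} E) v = k)) = (\<Sum>v\<in>{1..n}. ?f i v)"
      by (rule sum.cong) (auto simp: vertex_degree_insert[OF wf])
    then show ?thesis
      unfolding degree_count_eq_sum by (auto simp: vertex_degree_new[OF wf])
  qed
  have old: "(\<Sum>i\<in>?I. ?p i * ?f i v) =
      of_bool (?d v = k) * (1 - real k / ?q) + of_bool (Suc (?d v) = k) * real (k - 1) / ?q"
    if "v \<in> {1..n}" for v
  proof -
    have "?p i * ?f i v = of_bool (?d v = k) * ?p i +
        (of_bool (Suc (?d v) = k) - of_bool (?d v = k)) * (?p i * of_bool (i = v))" for i
      by (simp only: algebra_simps)
    then have "(\<Sum>i\<in>?I. ?p i * ?f i v) = of_bool (?d v = k) * (\<Sum>i\<in>?I. ?p i) +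
        (of_bool (Suc (?d v) = k) - of_bool (?d v = k)) * (\<Sum>i\<in>?I. ?p i * of_bool (i = v))"
      by (simp only: sum.distrib sum_distrib_left)
    also have "\<dots> = of_bool (?d v = k) +
        (of_bool (Suc (?d v) = k) - of_bool (?d v = k)) * (real (?d v) / ?q)"
      using that unfolding sum_attach_prob[OF wf] by (subst sum_attach_prob_select) auto
    also have "\<dots> = of_bool (?d v = k) * (1 - real k / ?q) + of_bool (Suc (?d v) = k) * real (k - 1) / ?q"
      by auto
    finally show ?thesis .
  qed
  have "(\<Sum>i\<in>?I. ?p i * of_bool (i = Suc n)) = 1 / ?q"
    by (simp add: attach_prob_new)
  moreover have "?p i * ?g i = of_bool (k = 1) * ?p i +
      (of_bool (k = 2) - of_bool (k = 1)) * (?p i * of_bool (i = Suc n))" for i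
    by (simp only: algebra_simps)
  then have "(\<Sum>i\<in>?I. ?p i * ?g i) = of_bool (k = 1) * (\<Sum>i\<in>?I. ?p i) +
      (of_bool (k = 2) - of_bool (k = 1)) * (\<Sum>i\<in>?I. ?p i * of_bool (i = Suc n))"
    by (simp only: sum.distrib sum_distrib_left)
  ultimately have "(\<Sum>i\<in>?I. ?p i * ?g i) =
      of_bool (k = 1) + (of_bool (k = 2) - of_bool (k = 1)) * (1 / ?q)"
    by (simp only: sum_attach_prob[OF wf] mult_1_right)
  then have new: "(\<Sum>i\<in>?I. ?p i * ?g i) = (of_bool (k = 1) * (2 * real n) + of_bool (k = 2)) / ?q"
    by (simp add: field_simps)
  have "?p i * real (degree_count (Suc n) k (insert {Suc n, i} E)) =
      (\<Sum>v\<in>{1..n}. ?p i * ?f i v) + ?p i * ?g i" for i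
    unfolding count by (subst distrib_left) (simp only: sum_distrib_left)
  then have "(\<Sum>i\<in>?I. ?p i * real (degree_count (Suc n) k (insert {Suc n, i} E))) =
      (\<Sum>i\<in>?I. \<Sum>v\<in>{1..n}. ?p i * ?f i v) + (\<Sum>i\<in>?I. ?p i * ?g i)"
    by (simp only: sum.distrib)
  also have "(\<Sum>i\<in>?I. \<Sum>v\<in>{1..n}. ?p i * ?f i v) = (\<Sum>v\<in>{1..n}. \<Sum>i\<in>?I. ?p i * ?f i v)"
    by (rule sum.swap)
  also have "\<dots> = (\<Sum>v\<in>{1..n}.
      of_bool (?d v = k) * (1 - real k / ?q) + of_bool (Suc (?d v) = k) * real (k - 1) / ?q)"
    by (rule sum.cong[OF refl old])
  also have "\<dots> = real (degree_count n k E) * (1 - real k / ?q) +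
      (\<Sum>v\<in>{1..n}. of_bool (Suc (?d v) = k)) * real (k - 1) / ?q"
    unfolding degree_count_eq_sum
    by (simp only: sum.distrib sum_distrib_right sum_divide_distrib)
  also have "(\<Sum>v\<in>{1..n}. of_bool (Suc (?d v) = k)) * real (k - 1) / ?q =
      real (degree_count n (k - 1) E) * real (k - 1) / ?q"
    unfolding degree_count_eq_sum by (cases k) simp_all
  finally show ?thesis unfolding new .
qed

definition mean_degree_count :: "nat \<Rightarrow> nat \<Rightarrow> real" where
  "mean_degree_count n k =
     measure_pmf.expectation (bollobas_riordan n) (\<lambda>E. real (degree_count n k E))"

definition mean_num_vertices :: "nat \<Rightarrow> nat \<Rightarrow> nat \<Rightarrow> real" where
  "mean_num_vertices n l k =
     measure_pmf.expectation (bollobas_riordan n) (\<lambda>E. real (num_vertices n l k E))"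

lemma integrable_bollobas_riordan [simp]:
  "integrable (measure_pmf (bollobas_riordan n)) (h :: edges \<Rightarrow> real)"
  by (rule integrable_measure_pmf_finite[OF finite_set_bollobas_riordan])

lemma mean_degree_count_Suc:
  assumes "n \<ge> 1"
  shows "mean_degree_count (Suc n) k =
    mean_degree_count n k * (1 - real k / (2 * real n + 1)) +
    mean_degree_count n (k - 1) * real (k - 1) / (2 * real n + 1) +
    (of_bool (k = 1) * (2 * real n) + of_bool (k = 2)) / (2 * real n + 1)"
proof -
  have "mean_degree_count (Suc n) k = measure_pmf.expectation (bollobas_riordan n)
      (\<lambda>E. real (degree_count n k E) * (1 - real k / (2 * real n + 1)) +
        real (degree_count n (k - 1) E) * real (k - 1) / (2 * real n + 1) +
        (of_bool (k = 1) * (2 * real n) + of_bool (k = 2)) / (2 * real n + 1))"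
    unfolding mean_degree_count_def expectation_bollobas_riordan_Suc[OF assms]
    by (intro integral_cong_AE AE_pmfI sum_attach_prob_degree_count wf_edges_bollobas_riordan)
       simp_all
  then show ?thesis unfolding mean_degree_count_def by simp
qed

lemma mean_num_vertices_Suc:
  assumes "n \<ge> 1"
  shows "mean_num_vertices (Suc n) l k =
    mean_num_vertices n l k * (1 - (2 * real l + real k) / (2 * real n + 1)) +
    mean_num_vertices n (l - 1) k * real (l - 1) / (2 * real n + 1) +
    (if k = 0 then 0 else mean_num_vertices n l (k - 1) * real (l + k - 1) / (2 * real n + 1)) +
    (if l = 1 then real k * mean_degree_count n k / (2 * real n + 1) else 0)"
proof -
  have "mean_num_vertices (Suc n) l k = measure_pmf.expectation (bollobas_riordan n)
      (\<lambda>E. real (num_vertices n l k E) * (1 - (2 * real l + real k) / (2 * real n + 1)) +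
    real (num_vertices n (l - 1) k E) * real (l - 1) / (2 * real n + 1) +
    (if k = 0 then 0 else real (num_vertices n l (k - 1) E) * real (l + k - 1) / (2 * real n + 1)) +
    (if l = 1 then real k * real (degree_count n k E) / (2 * real n + 1) else 0))"
    unfolding mean_num_vertices_def expectation_bollobas_riordan_Suc[OF assms]
    by (intro integral_cong_AE AE_pmfI sum_attach_prob_num_vertices wf_edges_bollobas_riordan
        neighbour_degree_identity_bollobas_riordan) simp_all
  then show ?thesis unfolding mean_num_vertices_def mean_degree_count_def
    by (cases "k = 0"; cases "l = 1") simp_all
qed

lemma mean_degree_count_1: "mean_degree_count 1 k = of_bool (k = 2)"
proof -
  have "{e \<in> {{1}}. 1 \<in> e} = {{1 :: nat}}" by auto
  then have "vertex_degree {{1}} 1 = 2" by (simp add: vertex_degree_def)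
  then show ?thesis by (simp add: mean_degree_count_def degree_count_eq_sum)
qed

lemma mean_num_vertices_1: "mean_num_vertices 1 l k = 0"
  by (simp add: mean_num_vertices_def num_vertices_def)

lemma mean_num_vertices_nonneg: "mean_num_vertices n l k \<ge> 0"
  by (simp add: mean_num_vertices_def)

section \<open>Deviation from the linear profile\<close>

lemma c_const_0 [simp]: "c_const 0 k = 0" "c_const l 0 = 0"
  by (simp_all add: c_const.simps)

lemma c_const_1:
  "c_const 1 k = (2 * real k ^ 2 + 14 * real k) /
     ((real k + 1) * (real k + 2) * (real k + 3) * (real k + 4))"
  by (cases "k = 0") (simp_all add: c_const.simps)

text \<open>The closed form for \<open>l = 1\<close> solves the recurrence with the source
  \<open>4 / ((k + 1) * (k + 2))\<close>, which is the slope of the linear profile of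
  \<open>k\<close> times the expected number of vertices of degree \<open>k\<close>.\<close>

lemma c_const_1_rec:
  assumes "k \<ge> 1"
  shows "c_const 1 k * (real k + 4) =
    real k * c_const 1 (k - 1) + 4 / ((real k + 1) * (real k + 2))"
proof -
  define x where "x = real k"
  have x: "x > 0" "real (k - 1) = x - 1" using assms by (auto simp: x_def)
  have "(2 * x ^ 2 + 14 * x) / ((x + 1) * (x + 2) * (x + 3) * (x + 4)) * (x + 4) =
      x * ((2 * (x - 1) ^ 2 + 14 * (x - 1)) / (x * (x + 1) * (x + 2) * (x + 3))) +
        4 / ((x + 1) * (x + 2))"
    using x(1) by (simp add: divide_simps) (simp add: algebra_simps power2_eq_square)
  then show ?thesis unfolding c_const_1 x(2) x_def[symmetric] by (simp add: algebra_simps)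
qed

lemma c_const_rec:
  assumes "l \<ge> 2" "k \<ge> 1"
  shows "c_const l k * (2 * real l + real k + 2) =
    real (l - 1) * c_const (l - 1) k + real (l + k - 1) * c_const l (k - 1)"
proof -
  have "c_const l k = (c_const l (k - 1) * real (l + k - 1) + c_const (l - 1) k * real (l - 1)) /
      (2 * real l + real k + 2)"
    using assms by (subst c_const.simps) (simp add: of_nat_diff add_divide_distrib)
  then show ?thesis by (simp add: field_simps)
qed

lemma c_const_nonneg: "c_const l k \<ge> 0"
proof (induction l k rule: c_const.induct)
  case (1 l k)
  show ?case
  proof (cases "l \<le> 1 \<or> k = 0")
    case True
    then have "l = 0 \<or> k = 0 \<or> l = 1" by auto
    then show ?thesis by (auto simp: c_const_1[simplified])
  next
    case False
    then show ?thesis using 1 by (subst c_const.simps) (auto intro!: add_nonneg_nonneg mult_nonneg_nonneg)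
  qed
qed

text \<open>Induction on \<open>l\<close> is enough: the term from \<open>l - 1\<close> is positive,
  and the term from \<open>k - 1\<close>, which is zero at \<open>k = 1\<close>, has only to be
  nonnegative. Positivity allows an absolute error to be turned into a relative one.\<close>

lemma c_const_pos:
  assumes "l \<ge> 1" "k \<ge> 1"
  shows "c_const l k > 0"
  using assms(1)
proof (induction l rule: nat_induct_at_least)
  case base
  have "real k > 0" using assms by simp
  then show ?case unfolding c_const_1 by (intro divide_pos_pos mult_pos_pos add_pos_pos) simp_all
next
  case (Suc l)
  have "0 < real l * c_const l k + real (l + k) * c_const (Suc l) (k - 1)"
    using Suc c_const_nonneg by (intro add_pos_nonneg mult_pos_pos mult_nonneg_nonneg) auto
  also have "\<dots> = c_const (Suc l) k * (2 * real (Suc l) + real k + 2)"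
    using c_const_rec[of "Suc l" k] Suc assms by simp
  finally show ?case by (simp add: zero_less_mult_iff)
qed

lemma abs_nonneg_combination_le:
  fixes x y z :: real
  assumes "\<bar>x\<bar> \<le> A" "\<bar>y\<bar> \<le> B" "\<bar>z\<bar> \<le> C" "0 \<le> a" "0 \<le> b" "0 \<le> c"
  shows "\<bar>x * a + y * b + z * c\<bar> \<le> A * a + B * b + C * c"
proof -
  have "\<bar>x * a + y * b + z * c\<bar> \<le> \<bar>x * a\<bar> + \<bar>y * b\<bar> + \<bar>z * c\<bar>" by linarith
  also have "\<dots> = \<bar>x\<bar> * a + \<bar>y\<bar> * b + \<bar>z\<bar> * c" using assms by (simp add: abs_mult)
  also have "\<dots> \<le> A * a + B * b + C * c" using assms by (intro add_mono mult_right_mono) auto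
  finally show ?thesis .
qed

text \<open>With \<open>q = 2 * t + 1\<close>, passing from \<open>t\<close> to \<open>t + 1\<close>
  replaces \<open>q / 2\<close> by \<open>q / 2 + 1\<close>. The quotients by \<open>q\<close>
  cancel against the profile \<open>q / 2\<close>, so a recurrence for the constants makes the
  profile an exact solution of the recurrence for the counts.\<close>

lemma linear_profile_step:
  fixes q :: real
  assumes "q > 0" "y * (m + 2) = a * s + b * u"
  shows "y * (q / 2 + 1) = y * (q / 2) * (1 - m / q) + a * (q / 2) * (s / q) + b * (q / 2) * (u / q)"
proof -
  have "y * (q / 2) * (1 - m / q) = y * (q / 2) - y * m / 2" using assms(1) by (simp add: field_simps)
  moreover have "a * (q / 2) * (s / q) + b * (q / 2) * (u / q) = (a * s + b * u) / 2"
    using assms(1) by (simp add: field_simps)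
  ultimately show ?thesis unfolding assms(2)[symmetric] by (simp add: field_simps)
qed

section \<open>Expected number of vertices of given degree\<close>

lemma mean_degree_count_eq_0:
  "t \<ge> 1 \<Longrightarrow> k > t + 1 \<Longrightarrow> mean_degree_count t k = 0"
proof (induction t arbitrary: k rule: nat_induct_at_least)
  case base
  then show ?case using mean_degree_count_1 by simp
next
  case (Suc t)
  then show ?case by (simp add: mean_degree_count_Suc)
qed

text \<open>The value is exact and differs from the profile \<open>2 / 3 * (t + 1 / 2)\<close> by
  the constant -1. Being exact, it also serves where degree 1 feeds into degree 2.\<close>

lemma mean_degree_count_leaves:
  "t \<ge> 1 \<Longrightarrow> mean_degree_count t 1 = (2 * real t - 2) / 3"
proof (induction t rule: nat_induct_at_least)
  case base
  then show ?case using mean_degree_count_1 by simp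
next
  case (Suc t)
  define q where "q = 2 * real t + 1"
  have q: "q > 0" "real t = (q - 1) / 2" by (simp_all add: q_def)
  have "mean_degree_count (Suc t) 1 = (2 * real t - 2) / 3 * (1 - 1 / q) + 2 * real t / q"
    unfolding mean_degree_count_Suc[OF Suc(1)] Suc(2) q_def by simp
  also have "\<dots> = (2 * real (Suc t) - 2) / 3" using q(1) unfolding of_nat_Suc q(2) by (simp add: field_simps)
  finally show ?case .
qed

text \<open>The linear profile is taken at \<open>t + 1/2\<close>, half of the normalising constant \<open>2 * t + 1\<close>,
  because it then solves the recurrence exactly for \<open>k \<ge> 3\<close>.\<close>

lemma mean_degree_count_estimate:
  "t \<ge> 1 \<Longrightarrow> k \<ge> 1 \<Longrightarrow>
    \<bar>real k * mean_degree_count t k - 4 / ((real k + 1) * (real k + 2)) * (real t + 1 / 2)\<bar> \<le> 3 / 2"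
proof (induction t arbitrary: k rule: nat_induct_at_least)
  case base
  define x where "x = real k"
  have x: "x \<ge> 1" using base by (simp add: x_def)
  have "6 * 1 \<le> (x + 1) * (x + 2)" using x mult_mono[of 2 "x + 1" 3 "x + 2"] by simp
  then have "6 / ((x + 1) * (x + 2)) \<le> 1" "0 \<le> 6 / ((x + 1) * (x + 2))"
    using x by (simp_all add: divide_le_eq)
  then have "\<bar>6 / ((x + 1) * (x + 2))\<bar> \<le> 3 / 2" by linarith
  moreover have "mean_degree_count 1 k = of_bool (k = 2)" by (rule mean_degree_count_1)
  \<comment> \<open>The constant \<open>3 / 2\<close> is attained here: at \<open>k = 2\<close> the
    deviation is \<open>2 - 1 / 2\<close>.\<close>
  ultimately show ?case by (cases "k = 2") (simp_all add: x_def abs_minus_commute)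
next
  case (Suc t)
  define q where "q = 2 * real t + 1"
  have q: "q > 0" "real t = (q - 1) / 2" by (simp_all add: q_def)
  let ?X = "mean_degree_count t"
  let ?y = "\<lambda>k::nat. 4 / ((real k + 1) * (real k + 2))"
  \<comment> \<open>For \<open>k \<le> 2 * t + 1\<close> the coefficient \<open>1 - k / q\<close> is
    nonnegative. For larger \<open>k\<close> the count after the step is zero, and the profile alone
    is small enough.\<close>
  consider "k = 1" | "k = 2" | "k \<ge> 3" "k \<le> 2 * t + 1" | "k \<ge> 2 * t + 2" "k \<ge> 3"
    using Suc.prems by linarith
  then show ?case
  proof cases
    case 1
    have "real k * mean_degree_count (Suc t) k -
        4 / ((real k + 1) * (real k + 2)) * (real (Suc t) + 1 / 2) = - 1"
      using mean_degree_count_leaves[of "Suc t"] unfolding 1 by (simp add: field_simps)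
    then show ?thesis by simp
  next
    case 2
    have "mean_degree_count (Suc t) 2 = ?X 2 * (1 - 2 / q) + ((2 * real t - 2) / 3 + 1) / q"
    proof -
      have X1: "?X (Suc 0) = (2 * real t - 2) / 3"
        using mean_degree_count_leaves[OF Suc(1)] by (simp only: One_nat_def)
      show ?thesis
        unfolding mean_degree_count_Suc[OF Suc(1)] q_def add_divide_distrib by (simp add: X1)
    qed
    \<comment> \<open>The leaves reaching degree 2 and the possible new loop add up to exactly
      \<open>1 / 3\<close>, so the deviation is merely multiplied by
      \<open>1 - 2 / q\<close>.\<close>
    also have "((2 * real t - 2) / 3 + 1) / q = 1 / 3"
      using q(1) unfolding q(2) by (simp add: field_simps)
    finally have "2 * mean_degree_count (Suc t) 2 - (real (Suc t) + 1 / 2) / 3 =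
        (2 * ?X 2 - (real t + 1 / 2) / 3) * (1 - 2 / q)"
      using q(1) unfolding of_nat_Suc q(2) by (simp add: field_simps)
    moreover have "\<bar>2 * ?X 2 - (real t + 1 / 2) / 3\<bar> \<le> 3 / 2" using Suc.IH[of 2] by simp
    moreover have "0 \<le> 1 - 2 / q" "1 - 2 / q \<le> 1" using Suc(1) by (simp_all add: q_def)
    ultimately have "\<bar>2 * mean_degree_count (Suc t) 2 - (real (Suc t) + 1 / 2) / 3\<bar> \<le> 3 / 2 * 1"
      by (simp only: abs_mult) (intro mult_mono, auto)
    then show ?thesis unfolding 2 by simp
  next
    case 3
    have y: "?y k * (real k + 2) = real k * ?y (k - 1)"
    proof -
      define x where "x = real k"
      have x: "real (k - 1) = x - 1" "x > 0" using 3 by (auto simp: x_def)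
      have "4 / ((x + 1) * (x + 2)) * (x + 2) = 4 / (x + 1)"
        using x(2) by (simp add: divide_simps)
      moreover have "x * (4 / (x * (x + 1))) = 4 / (x + 1)" using x(2) by simp
      ultimately show ?thesis unfolding x(1) x_def[symmetric] using x(2) by simp
    qed
    \<comment> \<open>The factor \<open>k\<close> on the count turns the weights into
      \<open>1 - k / q\<close> and \<open>k / q\<close>. These add up to 1, so a bound common to all
      \<open>k\<close> survives the step.\<close>
    have "real k * mean_degree_count (Suc t) k =
        real k * ?X k * (1 - real k / q) + real (k - 1) * ?X (k - 1) * (real k / q)"
      unfolding mean_degree_count_Suc[OF Suc(1)] q_def[symmetric]
      using 3 by (simp add: algebra_simps diff_divide_distrib)
    moreover have "?y k * (q / 2 + 1) = ?y k * (q / 2) * (1 - real k / q) +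
        ?y (k - 1) * (q / 2) * (real k / q) + 0 * (q / 2) * (0 / q)"
      using y by (intro linear_profile_step[OF q(1)]) simp
    ultimately have "real k * mean_degree_count (Suc t) k - ?y k * (q / 2 + 1) =
        (real k * ?X k - ?y k * (q / 2)) * (1 - real k / q) +
        (real (k - 1) * ?X (k - 1) - ?y (k - 1) * (q / 2)) * (real k / q) + 0 * 0"
      by (simp only: left_diff_distrib)
    also have "\<bar>\<dots>\<bar> \<le> 3 / 2 * (1 - real k / q) + 3 / 2 * (real k / q) + 0 * 0"
    proof (rule abs_nonneg_combination_le)
      have r: "q / 2 = real t + 1 / 2" by (simp add: q_def)
      show "\<bar>real k * ?X k - ?y k * (q / 2)\<bar> \<le> 3 / 2"
        unfolding r by (rule Suc.IH[OF Suc.prems])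
      show "\<bar>real (k - 1) * ?X (k - 1) - ?y (k - 1) * (q / 2)\<bar> \<le> 3 / 2"
        unfolding r by (rule Suc.IH) (use 3 in simp)
      show "0 \<le> 1 - real k / q" using 3(2) q(1) by (simp add: q_def divide_le_eq)
    qed (use q in simp_all)
    also have "\<dots> = 3 / 2" by (simp add: right_diff_distrib)
    finally have "\<bar>real k * mean_degree_count (Suc t) k - ?y k * (q / 2 + 1)\<bar> \<le> 3 / 2" .
    moreover have "q / 2 + 1 = real (Suc t) + 1 / 2" by (simp add: q_def field_simps)
    ultimately show ?thesis by (simp only:)
  next
    case 4
    have X: "mean_degree_count (Suc t) k = 0" using 4 Suc(1) by (intro mean_degree_count_eq_0) auto
    have k: "real k \<ge> 2 * real t + 2" using 4(1) by linarith
    have "(2 * real t + 3) * 4 \<le> (real k + 1) * (real k + 2)"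
      using k by (intro mult_mono) auto
    then have "4 / ((real k + 1) * (real k + 2)) * (real (Suc t) + 1 / 2) \<le> 3 / 2"
      by (simp add: divide_le_eq)
    moreover have "0 \<le> 4 / ((real k + 1) * (real k + 2)) * (real (Suc t) + 1 / 2)" by simp
    ultimately show ?thesis unfolding X by linarith
  qed
qed

section \<open>Expected number of loopless vertices of given degree and second degree\<close>

lemma mean_num_vertices_eq_0:
  "t \<ge> 1 \<Longrightarrow> l = 0 \<or> k = 0 \<or> l + k > t + 1 \<or> 2 * l + k > 2 * t \<Longrightarrow> mean_num_vertices t l k = 0"
proof (induction t arbitrary: l k rule: nat_induct_at_least)
  case base
  show ?case by (rule mean_num_vertices_1)
next
  case (Suc t)
  \<comment> \<open>A step raises \<open>l + k\<close> by at most 1 and \<open>2 * l + k\<close> by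
    at most 2, so both bounds pass to the predecessors. In the graph, \<open>2 * l + k\<close> is
    the total degree of a loopless vertex and its neighbours, and \<open>l + k\<close> counts
    distinct edges except that at most one loop is counted twice.\<close>
  have "mean_num_vertices t l k = 0" using Suc.prems by (intro Suc.IH) auto
  moreover have "mean_num_vertices t (l - 1) k * real (l - 1) = 0"
  proof (cases "l \<le> 1")
    case False
    then have "mean_num_vertices t (l - 1) k = 0" using Suc.prems by (intro Suc.IH) auto
    then show ?thesis by simp
  qed simp
  moreover have "(if k = 0 then 0
      else mean_num_vertices t l (k - 1) * real (l + k - 1) / (2 * real t + 1)) = 0"
  proof -
    have "mean_num_vertices t l (k - 1) = 0" if "k \<noteq> 0"
      using Suc.prems that by (intro Suc.IH) auto
    then show ?thesis by simp
  qed
  moreover have "(if l = 1 then real k * mean_degree_count t k / (2 * real t + 1) else 0) = 0"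
    using Suc mean_degree_count_eq_0[of t k] by auto
  ultimately show ?case
    unfolding mean_num_vertices_Suc[OF Suc(1)] by (simp only: mult_zero_left div_0 add_0)
qed

text \<open>The bound \<open>3 / 4\<close> reproduces itself because the weights
  \<open>1 - (k + 2) / q\<close> and \<open>k / q\<close> fall short of 1 by \<open>2 / q\<close>,
  which absorbs a source error of \<open>3 / 2\<close>. At \<open>k = 1\<close> the source error is
  exactly -1 and there is no predecessor, which gives \<open>1 / 3\<close>; this sharper value is
  needed since the relative bound there is only \<open>2 / 5\<close>.\<close>

lemma mean_num_vertices_leaves_estimate:
  "t \<ge> 1 \<Longrightarrow> k \<ge> 1 \<Longrightarrow>
    \<bar>mean_num_vertices t 1 k - c_const 1 k * (real t + 1 / 2)\<bar> \<le> (if k = 1 then 1 / 3 else 3 / 4)"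
proof (induction t arbitrary: k rule: nat_induct_at_least)
  case base
  define x where "x = real k"
  have x: "x \<ge> 1" using base by (simp add: x_def)
  have "c_const 1 k * (3 / 2) \<le> 1 / 5"
  proof -
    \<comment> \<open>In terms of \<open>x - 1\<close> the difference of the two sides has only
      nonnegative coefficients. It vanishes at \<open>k = 1\<close>, where \<open>1 / 5\<close> is
      attained.\<close>
    define y where "y = x - 1"
    have "2 * ((x + 1) * (x + 2) * (x + 3) * (x + 4)) - 15 * (2 * x ^ 2 + 14 * x) =
        2 * y ^ 4 + 28 * y ^ 3 + 112 * y ^ 2 + 38 * y"
      unfolding y_def by algebra
    moreover have "\<dots> \<ge> 0" using x by (simp add: y_def)
    ultimately have "15 * (2 * x ^ 2 + 14 * x) \<le> 2 * ((x + 1) * (x + 2) * (x + 3) * (x + 4))"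
      by linarith
    then show ?thesis unfolding c_const_1 x_def[symmetric] using x by (simp add: divide_le_eq)
  qed
  moreover have "c_const 1 k * (3 / 2) \<ge> 0" using c_const_nonneg by simp
  ultimately have "\<bar>mean_num_vertices 1 1 k - c_const 1 k * (real 1 + 1 / 2)\<bar> \<le> 1 / 5"
    unfolding mean_num_vertices_1 by simp
  then show ?case by (rule order_trans) simp
next
  case (Suc t)
  define q where "q = 2 * real t + 1"
  have q: "q > 0" "real t = (q - 1) / 2" by (simp_all add: q_def)
  have r: "q / 2 = real t + 1 / 2" by (simp add: q_def)
  let ?F = "mean_num_vertices t 1" and ?X = "mean_degree_count t" and ?c = "c_const 1"
  define y where "y = 4 / ((real k + 1) * (real k + 2))"
  have F: "mean_num_vertices (Suc t) 1 k =
      ?F k * (1 - (real k + 2) / q) + ?F (k - 1) * (real k / q) + real k * ?X k * (1 / q)"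
    unfolding mean_num_vertices_Suc[OF Suc(1)] using Suc.prems by (simp add: q_def add.commute)
  have c: "?c k * (q / 2 + 1) =
      ?c k * (q / 2) * (1 - (real k + 2) / q) + ?c (k - 1) * (q / 2) * (real k / q) + y * (q / 2) * (1 / q)"
    using c_const_1_rec[OF Suc.prems, folded y_def]
    by (intro linear_profile_step[OF q(1)]) (simp add: add.assoc mult.commute)
  have e: "mean_num_vertices (Suc t) 1 k - ?c k * (q / 2 + 1) =
      (?F k - ?c k * (q / 2)) * (1 - (real k + 2) / q) +
      (?F (k - 1) - ?c (k - 1) * (q / 2)) * (real k / q) +
      (real k * ?X k - y * (q / 2)) * (1 / q)"
    unfolding F c by (simp only: left_diff_distrib)
  have r': "real (Suc t) + 1 / 2 = q / 2 + 1" by (simp add: q_def field_simps)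
  \<comment> \<open>The condition \<open>k + 2 \<le> 2 * t + 1\<close> makes the first coefficient
    nonnegative. Outside it the count after the step is zero, except at \<open>k = 2\<close>,
    \<open>t = 1\<close>, which is computed directly.\<close>
  consider "k = 1" | "2 \<le> k" "k + 2 \<le> 2 * t + 1" | "k = 2" "t = 1" | "3 \<le> k" "2 * t \<le> k"
    using Suc by linarith
  then show ?case
  proof cases
    case 1
    have "real k * ?X k - y * (q / 2) = - 1"
      using mean_degree_count_leaves[OF Suc(1)] unfolding y_def 1 q(2) by (simp add: field_simps)
    moreover have "?F (k - 1) - ?c (k - 1) * (q / 2) = 0"
      using mean_num_vertices_eq_0[OF Suc(1), of 1 0] 1 by simp
    moreover have "\<bar>?F k - ?c k * (q / 2)\<bar> \<le> 1 / 3"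
      using Suc.IH[of 1] 1 unfolding r by simp
    moreover have "0 \<le> 1 - (real k + 2) / q" using 1 Suc(1) by (simp add: q_def)
    ultimately have "\<bar>mean_num_vertices (Suc t) 1 k - ?c k * (q / 2 + 1)\<bar> \<le>
        1 / 3 * (1 - (real k + 2) / q) + 0 * (real k / q) + 1 * (1 / q)"
      unfolding e using q(1) by (intro abs_nonneg_combination_le) auto
    also have "\<dots> = 1 / 3" using 1 q by (simp add: field_simps)
    finally show ?thesis unfolding r' using 1 by simp
  next
    case 2
    have "\<bar>mean_num_vertices (Suc t) 1 k - ?c k * (q / 2 + 1)\<bar> \<le>
        3 / 4 * (1 - (real k + 2) / q) + 3 / 4 * (real k / q) + 3 / 2 * (1 / q)"
      unfolding e
    proof (rule abs_nonneg_combination_le)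
      show "\<bar>?F k - ?c k * (q / 2)\<bar> \<le> 3 / 4"
        using Suc.IH[of k] 2 unfolding r by simp
      show "\<bar>?F (k - 1) - ?c (k - 1) * (q / 2)\<bar> \<le> 3 / 4"
      proof -
        have "\<bar>?F (k - 1) - ?c (k - 1) * (q / 2)\<bar> \<le> (if k - 1 = 1 then 1 / 3 else 3 / 4)"
          unfolding r by (rule Suc.IH) (use 2 in simp)
        also have "\<dots> \<le> 3 / 4" by simp
        finally show ?thesis .
      qed
      show "\<bar>real k * ?X k - y * (q / 2)\<bar> \<le> 3 / 2"
        unfolding r y_def by (rule mean_degree_count_estimate[OF Suc(1) Suc.prems])
      show "0 \<le> 1 - (real k + 2) / q" using 2(2) q(1) by (simp add: q_def divide_le_eq)
    qed (use q in simp_all)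
    also have "\<dots> = 3 / 4" using q by (simp add: field_simps)
    finally show ?thesis unfolding r' using 2 by simp
  next
    case 3
    have "mean_num_vertices 1 1 k = 0" for k by (rule mean_num_vertices_1)
    moreover have "mean_degree_count 1 2 = 1" using mean_degree_count_1 by simp
    ultimately have "mean_num_vertices (Suc t) 1 k = 2 / 3"
      using F unfolding 3 q_def by simp
    moreover have "?c k = 1 / 10" unfolding c_const_1 3 by simp
    ultimately show ?thesis unfolding r' q_def 3 by simp
  next
    case 4
    define x where "x = real k"
    have x: "x \<ge> 3" "x \<ge> 2 * real t" using 4 by (auto simp: x_def)
    have "mean_num_vertices (Suc t) 1 k = 0"
      using 4 by (intro mean_num_vertices_eq_0) auto
    moreover have "?c k * (q / 2 + 1) \<le> 3 / 4"
    proof -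
      \<comment> \<open>Since \<open>2 * t \<le> k\<close>, the factor \<open>q / 2 + 1\<close> is
        at most \<open>(x + 3) / 2\<close>, which cancels a factor of the denominator of
        \<open>c_const 1 k\<close>.\<close>
      have "?c k * (q / 2 + 1) \<le> ?c k * ((x + 3) / 2)"
        using x c_const_nonneg by (intro mult_left_mono) (auto simp: q_def field_simps)
      also have "\<dots> = (x ^ 2 + 7 * x) / ((x + 1) * (x + 2) * (x + 4))"
        unfolding c_const_1 x_def[symmetric] using x
        by (simp add: divide_simps) (simp add: algebra_simps)
      also have "\<dots> \<le> 3 / 4"
      proof -
        have "3 * ((x + 1) * (x + 2) * (x + 4)) - 4 * (x ^ 2 + 7 * x) =
            3 * x ^ 3 + 17 * x ^ 2 + 14 * x + 24" by algebra
        moreover have "\<dots> \<ge> 0" using x by simp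
        ultimately show ?thesis using x by (simp add: divide_le_eq)
      qed
      finally show ?thesis .
    qed
    moreover have "?c k * (q / 2 + 1) \<ge> 0" using q c_const_nonneg by simp
    ultimately show ?thesis unfolding r' using 4 by simp
  qed
qed

text \<open>With \<open>M = k + 2\<close> the bound reads \<open>M * (M - 2) * c_const 1 k\<close>,
  the form required to start the general estimate. It is at least \<open>2 / 5\<close> for
  \<open>k = 1\<close> and at least \<open>3 / 4\<close> for \<open>k \<ge> 2\<close>.\<close>

lemma mean_num_vertices_leaves_relative_estimate:
  assumes "t \<ge> 1" "k \<ge> 1"
  shows "\<bar>mean_num_vertices t 1 k - c_const 1 k * (real t + 1 / 2)\<bar> \<le>
    (real k + 2) * real k * c_const 1 k"
proof -
  define x where "x = real k"
  have x: "x \<ge> 1" using assms by (simp add: x_def)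
  have c: "(real k + 2) * real k * c_const 1 k =
      (2 * x ^ 3 + 14 * x ^ 2) / ((x + 1) * (x + 3) * (x + 4))"
    unfolding c_const_1 x_def[symmetric] using x
    by (simp add: divide_simps) (simp add: algebra_simps power2_eq_square power3_eq_cube)
  have "(if k = 1 then 1 / 3 else 3 / 4) \<le> (real k + 2) * real k * c_const 1 k"
  proof (cases "k = 1")
    case True
    then show ?thesis unfolding c by (simp add: x_def)
  next
    case False
    then have "x \<ge> 2" using assms by (simp add: x_def)
    define y where "y = x - 2"
    have "4 * (2 * x ^ 3 + 14 * x ^ 2) - 3 * ((x + 1) * (x + 3) * (x + 4)) =
        5 * y ^ 3 + 62 * y ^ 2 + 131 * y + 18"
      unfolding y_def by algebra
    moreover have "y \<ge> 0" using \<open>x \<ge> 2\<close> by (simp add: y_def)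
    then have "5 * y ^ 3 + 62 * y ^ 2 + 131 * y + 18 \<ge> 0" by simp
    ultimately show ?thesis unfolding c using False x by (simp add: le_divide_eq)
  qed
  then show ?thesis using mean_num_vertices_leaves_estimate[OF assms] by linarith
qed

text \<open>A bound proportional to \<open>c_const l k\<close> lets the recurrence of the constants
  combine the errors of the two predecessors. Vertices of degree 1 are taken from the preceding
  estimate, because their recurrence has a source term.\<close>

lemma mean_num_vertices_estimate:
  "t \<ge> 1 \<Longrightarrow> l \<ge> 1 \<Longrightarrow> k \<ge> 1 \<Longrightarrow>
    \<bar>mean_num_vertices t l k - c_const l k * (real t + 1 / 2)\<bar> \<le>
      (2 * real l + real k) * (2 * real l + real k - 2) * c_const l k"
proof (induction t arbitrary: l k rule: nat_induct_at_least)
  case base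
  define M where "M = 2 * real l + real k"
  have M: "M \<ge> 3" using base by (simp add: M_def)
  have "3 * 1 \<le> M * (M - 2)" using M by (intro mult_mono) auto
  then have "c_const l k * (3 / 2) \<le> c_const l k * (M * (M - 2))"
    using c_const_nonneg by (intro mult_left_mono) auto
  moreover have "0 \<le> c_const l k" by (rule c_const_nonneg)
  ultimately show ?case unfolding mean_num_vertices_1 M_def[symmetric] by (simp add: mult.commute)
next
  case (Suc t)
  show ?case
  proof (cases "l = 1")
    case True
    show ?thesis
      using mean_num_vertices_leaves_relative_estimate[of "Suc t" k] Suc.prems
      unfolding True by (simp add: add.commute)
  next
    case False
    then have l: "l \<ge> 2" using Suc.prems by simp
    define M where "M = 2 * real l + real k"
    define q where "q = 2 * real t + 1"
    define c a b where "c = c_const l k" and "a = c_const (l - 1) k" and "b = c_const l (k - 1)"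
    define F A B where "F = mean_num_vertices t l k" and "A = mean_num_vertices t (l - 1) k"
      and "B = mean_num_vertices t l (k - 1)"
    have q: "q > 0" by (simp add: q_def)
    have r: "real t + 1 / 2 = q / 2" "real (Suc t) + 1 / 2 = q / 2 + 1"
      by (simp_all add: q_def field_simps)
    have M: "M \<ge> 5" using l Suc.prems by (simp add: M_def)
    have c: "c > 0" and ab: "a \<ge> 0" "b \<ge> 0"
      using c_const_pos[of l k] l Suc.prems by (auto simp: c_def a_def b_def c_const_nonneg)
    have rec: "c * (M + 2) = real (l - 1) * a + real (l + k - 1) * b"
      unfolding c_def a_def b_def M_def using c_const_rec[OF l] Suc.prems by simp
    have step: "mean_num_vertices (Suc t) l k =
        F * (1 - M / q) + A * (real (l - 1) / q) + B * (real (l + k - 1) / q)"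
      unfolding mean_num_vertices_Suc[OF Suc(1)] F_def A_def B_def M_def q_def
      using l Suc.prems by simp
    have A: "\<bar>A - a * (q / 2)\<bar> \<le> (M - 2) * (M - 4) * a"
      using Suc.IH[of "l - 1" k] l Suc.prems unfolding r A_def a_def M_def
      by (simp add: of_nat_diff algebra_simps)
    have goal: "\<bar>mean_num_vertices (Suc t) l k - c * (q / 2 + 1)\<bar> \<le> M * (M - 2) * c"
    proof (cases "2 * l + k \<le> 2 * t + 1")
      case True
      have B: "\<bar>B - b * (q / 2)\<bar> \<le> (M - 1) * (M - 3) * b"
      proof (cases "k = 1")
        case True
        then show ?thesis
          using mean_num_vertices_eq_0[OF Suc(1), of l 0] by (simp add: B_def b_def)
      next
        case False
        then show ?thesis
          using Suc.IH[of l "k - 1"] l Suc.prems unfolding r B_def b_def M_def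
          by (simp add: of_nat_diff algebra_simps)
      qed
      \<comment> \<open>The two predecessors have \<open>M - 2\<close> and \<open>M - 1\<close> in
        place of \<open>M\<close>. Giving both the larger error factor lets \<open>rec\<close>
        collapse their sum into a multiple of \<open>c\<close>.\<close>
      have "(M - 2) * (M - 4) * a \<le> (M - 1) * (M - 3) * a"
        using M ab by (intro mult_right_mono mult_mono) auto
      then have A': "\<bar>A - a * (q / 2)\<bar> \<le> (M - 1) * (M - 3) * a" using A by linarith
      have F: "\<bar>F - c * (q / 2)\<bar> \<le> M * (M - 2) * c"
        using Suc.IH[of l k] Suc.prems unfolding r F_def c_def M_def by simp
      have "c * (q / 2 + 1) = c * (q / 2) * (1 - M / q) + a * (q / 2) * (real (l - 1) / q) +
          b * (q / 2) * (real (l + k - 1) / q)"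
        by (rule linear_profile_step[OF q]) (simp add: rec mult.commute)
      then have "mean_num_vertices (Suc t) l k - c * (q / 2 + 1) =
          (F - c * (q / 2)) * (1 - M / q) + (A - a * (q / 2)) * (real (l - 1) / q) +
          (B - b * (q / 2)) * (real (l + k - 1) / q)"
        unfolding step by (simp only: left_diff_distrib)
      also have "\<bar>\<dots>\<bar> \<le> M * (M - 2) * c * (1 - M / q) +
          (M - 1) * (M - 3) * a * (real (l - 1) / q) +
          (M - 1) * (M - 3) * b * (real (l + k - 1) / q)"
      proof (rule abs_nonneg_combination_le[OF F A' B])
        have "M \<le> q" using True unfolding M_def q_def by linarith
        then show "0 \<le> 1 - M / q" using q by (simp add: divide_le_eq)
      qed (use q in simp_all)
      also have "\<dots> = M * (M - 2) * c * (1 - M / q) +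
          (M - 1) * (M - 3) * (real (l - 1) * a + real (l + k - 1) * b) / q"
        by (simp add: distrib_left add_divide_distrib mult_ac)
      \<comment> \<open>The surplus is
        \<open>M * (M - 2) * M - (M - 1) * (M - 3) * (M + 2) = 5 * M - 6\<close>.\<close>
      also have "\<dots> = M * (M - 2) * c - (5 * M - 6) * c / q"
        unfolding rec[symmetric] using q
        by (simp add: divide_simps) (simp add: algebra_simps)
      also have "\<dots> \<le> M * (M - 2) * c" using M c q by simp
      finally show ?thesis .
    next
      case False
      then have qM: "q \<le> M - 1" unfolding q_def M_def by linarith
      \<comment> \<open>Now \<open>2 * l + k\<close> and \<open>2 * l + (k - 1)\<close> both exceed
        \<open>2 * t\<close>. Only \<open>A\<close>, whose value of \<open>M\<close> is smaller by
        2, can be nonzero.\<close>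
      have "F = 0" unfolding F_def using False Suc(1) by (intro mean_num_vertices_eq_0) auto
      moreover have "B = 0" unfolding B_def using False Suc(1) by (intro mean_num_vertices_eq_0) auto
      ultimately have step': "mean_num_vertices (Suc t) l k = A * (real (l - 1) / q)"
        unfolding step by simp
      have "0 \<le> mean_num_vertices (Suc t) l k" by (rule mean_num_vertices_nonneg)
      moreover have "c * (q / 2 + 1) \<le> M * (M - 2) * c"
      proof -
        have "M * 3 \<le> M * (M - 2)" using M by (intro mult_left_mono) auto
        then have "q / 2 + 1 \<le> M * (M - 2)" using qM M by linarith
        then show ?thesis using c by (simp add: mult.commute)
      qed
      moreover have "mean_num_vertices (Suc t) l k \<le> c * (q / 2 + 1) + M * (M - 2) * c"
      proof (cases "2 * l + k = 2 * t + 2")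
        \<comment> \<open>This is the only borderline value: from
          \<open>2 * l + k = 2 * t + 3\<close> on, the count after the step is zero.\<close>
        case True
        then have q_eq: "q = M - 1" unfolding q_def M_def by linarith
        have "mean_num_vertices (Suc t) l k \<le> (q / 2 + (M - 2) * (M - 4)) * a * (real (l - 1) / q)"
          unfolding step' using A q by (intro mult_right_mono) (auto simp: algebra_simps)
        also have "\<dots> = (q / 2 + (M - 2) * (M - 4)) * (real (l - 1) * a) / q"
          by simp
        \<comment> \<open>Discarding the nonnegative term with \<open>b\<close> in
          \<open>rec\<close> bounds \<open>(l - 1) * a\<close> by
          \<open>c * (M + 2)\<close>.\<close>
        also have "\<dots> \<le> (q / 2 + (M - 2) * (M - 4)) * (c * (M + 2)) / q"
          unfolding rec using q M ab by (intro divide_right_mono mult_left_mono) auto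
        also have "\<dots> \<le> (q / 2 + 1 + M * (M - 2)) * c"
        proof -
          have "(q / 2 + (M - 2) * (M - 4)) * (M + 2) \<le> (q / 2 + 1 + M * (M - 2)) * q"
          proof -
            \<comment> \<open>Here \<open>l \<ge> 2\<close> and \<open>k \<ge> 1\<close> give
              \<open>M \<ge> 5\<close>, and in \<open>M - 5\<close> all coefficients of the
              difference are positive.\<close>
            define y where "y = M - 5"
            have "(q / 2 + 1 + M * (M - 2)) * q - (q / 2 + (M - 2) * (M - 4)) * (M + 2) =
                y ^ 2 + 31 / 2 * y + 37"
              unfolding q_eq y_def by (simp add: field_simps power2_eq_square)
            moreover have "\<dots> \<ge> 0" using M by (simp add: y_def)
            ultimately show ?thesis by linarith
          qed
          from mult_right_mono[OF this, of c] show ?thesis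
            using q c by (simp add: divide_le_eq mult_ac)
        qed
        also have "\<dots> = c * (q / 2 + 1) + M * (M - 2) * c" by (simp add: algebra_simps)
        finally show ?thesis .
      next
        case neq: False
        have "mean_num_vertices (Suc t) l k = 0"
          using False neq by (intro mean_num_vertices_eq_0) auto
        then show ?thesis using c q M by simp
      qed
      ultimately show ?thesis by linarith
    qed
    show ?thesis using goal unfolding c_def M_def r .
  qed
qed

theorem theorem4:
  fixes n l k :: nat
  assumes "n \<ge> 1"
  shows "((l, k) \<noteq> (0, 1) \<longrightarrow>
           (\<exists>\<theta>::real.
              measure_pmf.expectation (bollobas_riordan n) (\<lambda>E. real (num_vertices n l k E))
                = real n * c_const l k * (1 + \<theta>) \<and>
              \<bar>\<theta>\<bar> < (2 * real l + real k - 1)\<^sup>2 / real n)) \<and>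
         ((l, k) = (0, 1) \<longrightarrow>
           measure_pmf.expectation (bollobas_riordan n) (\<lambda>E. real (num_vertices n l k E))
             = real n * c_const l k \<and>
           real n * c_const l k = 0)"
proof (cases "l = 0 \<or> k = 0")
  case True
  then have "measure_pmf.expectation (bollobas_riordan n) (\<lambda>E. real (num_vertices n l k E)) = 0"
    using mean_num_vertices_eq_0[OF assms] unfolding mean_num_vertices_def by blast
  moreover have "c_const l k = 0" using True by auto
  moreover have "0 < (2 * real l + real k - 1)\<^sup>2 / real n" if "(l, k) \<noteq> (0, 1)"
  proof -
    \<comment> \<open>The choice \<open>\<theta> = 0\<close> meets the strict bound as soon as its
      right-hand side is positive; it is zero only for the pair \<open>(0, 1)\<close>.\<close>
    have "2 * l + k \<noteq> 1" using that by (cases l) auto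
    then have "2 * real l + real k - 1 \<noteq> 0" by linarith
    then show ?thesis using assms by simp
  qed
  ultimately show ?thesis by (auto intro!: exI[of _ 0])
next
  case False
  define M where "M = 2 * real l + real k"
  define F where "F = mean_num_vertices n l k"
  define c where "c = c_const l k"
  have c: "c > 0" using False c_const_pos by (simp add: c_def)
  have n: "real n > 0" using assms by simp
  have "\<bar>F - c * (real n + 1 / 2)\<bar> \<le> M * (M - 2) * c"
    unfolding F_def c_def M_def using False assms by (intro mean_num_vertices_estimate) auto
  \<comment> \<open>The spare \<open>c\<close> exceeds the shift \<open>c / 2\<close> of the
    profile, which makes the next inequality strict.\<close>
  also have "M * (M - 2) * c = (M - 1)\<^sup>2 * c - c" by (simp add: power2_eq_square algebra_simps)
  finally have "\<bar>F - c * real n\<bar> < (M - 1)\<^sup>2 * c" using c by (simp add: distrib_left abs_if split: if_splits)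
  then have "\<bar>F - c * real n\<bar> / (c * real n) < (M - 1)\<^sup>2 / real n"
    using c n by (simp add: divide_simps mult_ac)
  moreover have "\<bar>F / (c * real n) - 1\<bar> = \<bar>F - c * real n\<bar> / (c * real n)"
  proof -
    have "F / (c * real n) - 1 = (F - c * real n) / (c * real n)"
      using c n by (simp add: diff_divide_distrib)
    then show ?thesis using c n by (simp add: abs_mult)
  qed
  ultimately have "\<bar>F / (c * real n) - 1\<bar> < (M - 1)\<^sup>2 / real n" by simp
  moreover have "F = real n * c * (1 + (F / (c * real n) - 1))" using c n by simp
  ultimately have "\<exists>\<theta>. F = real n * c * (1 + \<theta>) \<and> \<bar>\<theta>\<bar> < (M - 1)\<^sup>2 / real n"
    by blast
  then show ?thesis
    using False unfolding F_def c_def M_def mean_num_vertices_def by simp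
qed

end
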